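(* There exist no triples $(\alpha, n, q)$ of integers such that $\alpha > 1$, $q$ is a prime with $q \equiv 1 \bmod 4$, and $2n^{2} = \sigma(q^{\alpha})$.
   Context: For a positive integer $m$, $\sigma(m)$ denotes the sum of the positive divisors of $m$; thus for $q$ prime and $\alpha \geq 0$, $\sigma(q^{\alpha}) = 1 + q + \cdots + q^{\alpha}$. *)

theory Defs
  imports "HOL-Number_Theory.Number_Theory"
begin

(* Only meaningful for m > 0; at m = 0 the index set is infinite and the sum is 0. *)
definition sigma :: "int \<Rightarrow> int" where
  "sigma m = (\<Sum>d | 0 < d \<and> d dvd m. d)"

lemma sigma_prime_power:
  fixes q :: int
  assumes "prime q"
  shows "sigma (q ^ a) = (\<Sum>i\<le>a. q ^ i)"
proof -
  have q: "q > 1" using assms by (simp add: prime_gt_1_int)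
  have "{d. 0 < d \<and> d dvd q ^ a} = (\<lambda>i. q ^ i) ` {..a}" (is "?L = ?R")
  proof
    show "?L \<subseteq> ?R"
    proof
      fix d assume d: "d \<in> ?L"
      then obtain i where "i \<le> a" "normalize d = normalize (q ^ i)"
        using divides_primepow_weak[OF assms, of d a] by auto
      with d q show "d \<in> ?R" by auto
    qed
    show "?R \<subseteq> ?L" using q by (auto intro: le_imp_power_dvd)
  qed
  moreover have "inj_on (\<lambda>i. q ^ i) {..a}" using q by (auto intro!: inj_onI)
  ultimately show ?thesis by (simp add: sigma_def sum.reindex)
qed

end

theory Submission
  imports Defs "HOL-Computational_Algebra.Nth_Powers"
begin

text \<open>
  Write \<open>S k\<close> for the repunit \<open>1 + q + \<dots> + q ^ (k - 1)\<close>.  As \<open>q\<close> is odd, \<open>S N\<close> is even only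
  if \<open>N\<close> is, so \<open>2 n\<^sup>2 = S N\<close> forces \<open>N = 2 k\<close>, and then \<open>n\<^sup>2 = S k \<cdot> (q ^ k + 1) / 2\<close>.
  Because \<open>q \<equiv> 1\<close> modulo 4, the two factors are coprime (\<open>half_power_plus_one\<close>), so both are
  squares: \<open>S k = a\<^sup>2\<close> and \<open>q ^ k + 1 = 2 b\<^sup>2\<close>.  Here \<open>N > 2\<close> means \<open>k > 1\<close>.

  If \<open>k = 2 h\<close> is even, the same factorisation \<open>a\<^sup>2 = 2 S h \<cdot> (q ^ h + 1) / 2\<close> gives a second
  relation \<open>q ^ h + 1 = 2 c\<^sup>2\<close>.  With \<open>b, c \<ge> 0\<close> and \<open>Q = q ^ h\<close> one has \<open>2 (b - c) (b + c) = Q (Q - 1)\<close>, and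
  since \<open>Q\<close> is a prime power it must divide one of the two factors on the left.  Their size leaves
  only \<open>b + c = Q\<close>, which leads to \<open>Q = 7\<close> (\<open>no_simultaneous_squares\<close>).

  If \<open>k = 2 m + 1\<close> is odd, \<open>S k = a\<^sup>2\<close> says that \<open>(q ^ m, a)\<close> solves
  \<open>q X\<^sup>2 - (q - 1) Y\<^sup>2 = 1\<close>.  All positive solutions of this Pell type equation are obtained from
  \<open>(1, 1)\<close>, by \<open>X \<surd>q + Y \<surd>(q - 1) = (\<surd>q + \<surd>(q - 1)) ^ j\<close> with \<open>j\<close> odd
  (\<open>pell_pos_solution_power\<close>).  The binomial expansion of \<open>X\<close> starts with \<open>j (q - 1) ^ ((j - 1) / 2)\<close>,
  and for \<open>q \<ge> 5\<close> every later term contains strictly more factors \<open>q\<close> than \<open>j\<close> does.  So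
  \<open>X = q ^ m\<close> divides \<open>j\<close> (\<open>prime_power_dvd_binomial_sum\<close>), although \<open>X > j\<close> as soon as \<open>j > 1\<close>
  (\<open>no_odd_repunit_square\<close>).
\<close>

section \<open>Coprime factors of repunits\<close>

lemma coprime_mult_square_int:
  fixes a b n :: int
  assumes "coprime a b" "a > 0" "b > 0" "a * b = n\<^sup>2"
  shows "\<exists>c. a = c\<^sup>2" and "\<exists>c. b = c\<^sup>2"
proof -
  have *: "nat a * nat b = (nat \<bar>n\<bar>)\<^sup>2"
  proof -
    have "int (nat a * nat b) = int ((nat \<bar>n\<bar>)\<^sup>2)"
      using assms by simp
    then show ?thesis by linarith
  qed
  have "coprime (nat a) (nat b)"
    using assms(1-3) by (simp add: coprime_int_iff[symmetric] del: coprime_int_iff)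
  moreover have "is_square (nat a * nat b)"
    unfolding * by (rule is_nth_powerI[OF refl])
  ultimately have "is_square (nat a)" "is_square (nat b)"
    using is_nth_power_mult_coprime_natD assms(2,3) by simp_all
  then obtain x y where "nat a = x\<^sup>2" "nat b = y\<^sup>2"
    unfolding is_nth_power_def by blast
  then have "a = int (x\<^sup>2)" "b = int (y\<^sup>2)"
    using assms(2,3) by linarith+
  then have "a = (int x)\<^sup>2" "b = (int y)\<^sup>2" by simp_all
  then show "\<exists>c. a = c\<^sup>2" "\<exists>c. b = c\<^sup>2" by blast+
qed

lemma geometric_sum_mult:
  fixes q :: int
  shows "(q - 1) * (\<Sum>i<k. q ^ i) = q ^ k - 1"
proof (induction k)
  case (Suc k)
  then show ?case by (simp only: sum.lessThan_Suc distrib_left) (simp add: left_diff_distrib)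
qed simp

lemma geometric_sum_double:
  fixes q :: int
  shows "(\<Sum>i<2 * k. q ^ i) = (\<Sum>i<k. q ^ i) * (q ^ k + 1)"
proof (cases "q = 1")
  case False
  have "(q - 1) * (\<Sum>i<2 * k. q ^ i) = (q - 1) * ((\<Sum>i<k. q ^ i) * (q ^ k + 1))"
    unfolding mult.assoc[symmetric] geometric_sum_mult
    by (simp add: algebra_simps power_add[symmetric] mult_2_right)
  then show ?thesis using False by simp
qed simp

text \<open>
  A common divisor of \<open>S k\<close> and \<open>(q ^ k + 1) / 2\<close> divides both \<open>q ^ k - 1 = (q - 1) S k\<close> and
  \<open>q ^ k + 1\<close>, hence 2; but \<open>(q ^ k + 1) / 2\<close> is odd because \<open>q ^ k \<equiv> 1\<close> modulo 4.
\<close>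

lemma half_power_plus_one:
  fixes q :: int
  assumes "[q = 1] (mod 4)" "q > 0"
  obtains r where "q ^ k + 1 = 2 * r" "odd r" "r > 0" "coprime (\<Sum>i<k. q ^ i) r"
proof -
  have "[q ^ k = 1] (mod 4)" using cong_pow[OF assms(1), of k] by simp
  then obtain t where t: "q ^ k = 1 + 4 * t"
    by (metis cong_iff_lin cong_sym)
  define r where "r = 2 * t + 1"
  have r: "q ^ k + 1 = 2 * r" "odd r" using t by (auto simp: r_def)
  have pos: "r > 0" using r(1) assms(2) zero_less_power[of q k] by linarith
  have "coprime (\<Sum>i<k. q ^ i) r"
  proof (rule coprimeI)
    fix d assume d: "d dvd (\<Sum>i<k. q ^ i)" "d dvd r"
    have "d dvd q ^ k - 1" unfolding geometric_sum_mult[symmetric] using d(1) by simp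
    moreover have "q ^ k - 1 = 2 * r - 2" using r(1) by simp
    ultimately have "d dvd 2 * r - (2 * r - 2)" using d(2) by (metis dvd_diff dvd_mult)
    then have "d dvd 2" by simp
    moreover have "coprime r 2" using r(2) by simp
    ultimately show "is_unit d" using d(2) coprime_common_divisor by blast
  qed
  with r pos that show ?thesis by blast
qed

section \<open>Even exponents\<close>

text \<open>
  Put \<open>B = \<bar>b\<bar>\<close> and \<open>C = \<bar>c\<bar>\<close>.  Subtracting the two equations gives \<open>2 (B - C) (B + C) = Q (Q - 1)\<close> for \<open>Q = q ^ h\<close>, where
  \<open>0 \<le> C < B < Q\<close>.  The prime \<open>q\<close> cannot divide both \<open>B - C\<close> and \<open>B + C\<close>, since it would then
  divide \<open>B\<close> and \<open>2 B\<^sup>2 - Q\<^sup>2 = 1\<close>.  Hence all of \<open>Q\<close> divides one of the two factors, and only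
  \<open>B + C = Q\<close> is compatible with the bounds.  Then \<open>2 (B - C) = Q - 1\<close>, so
  \<open>4 C = Q + 1 = 2 C\<^sup>2\<close>, \<open>C = 2\<close> and \<open>Q = 7\<close>, which is not congruent to 1 modulo 4.
\<close>

lemma no_simultaneous_squares:
  fixes q b c :: int
  assumes q: "prime q" "[q = 1] (mod 4)" and h: "h > 0"
    and c: "q ^ h + 1 = 2 * c\<^sup>2" and b: "(q ^ h)\<^sup>2 + 1 = 2 * b\<^sup>2"
  shows False
proof -
  define Q where "Q = q ^ h"
  define B C where "B = \<bar>b\<bar>" and "C = \<bar>c\<bar>"
  have q1: "q > 1" using q(1) prime_gt_1_int by blast
  have Q1: "Q > 1" unfolding Q_def using q1 h by (simp add: one_less_power)
  have Q: "Q + 1 = 2 * C\<^sup>2" "Q\<^sup>2 + 1 = 2 * B\<^sup>2" "B \<ge> 0" "C \<ge> 0"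
    using b c by (auto simp: Q_def B_def C_def)
  have Qmod: "[Q = 1] (mod 4)" using cong_pow[OF q(2), of h] by (simp add: Q_def)
  have q_ndvd_2: "\<not> q dvd 2"
  proof
    assume "q dvd 2"
    then have "q = 2" using q1 zdvd_imp_le by fastforce
    then show False using q(2) by (simp add: cong_def)
  qed
  have dvd: "Q dvd (B - C) * (B + C)"
  proof -
    have "Q * (Q - 1) = 2 * ((B - C) * (B + C))"
      using Q(1,2) by (simp add: algebra_simps power2_eq_square)
    then have "Q dvd 2 * ((B - C) * (B + C))" by (metis dvd_triv_left)
    moreover have "coprime Q 2"
      using prime_imp_coprime[OF q(1) q_ndvd_2] by (simp add: Q_def)
    ultimately show ?thesis by (simp add: coprime_dvd_mult_right_iff)
  qed
  have not_both: "\<not> (q dvd B - C \<and> q dvd B + C)"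
  proof
    assume "q dvd B - C \<and> q dvd B + C"
    then have "q dvd (B - C) + (B + C)" by (meson dvd_add)
    then have "q dvd 2 * B" by simp
    then have "q dvd B" using q(1) q_ndvd_2 prime_dvd_multD by blast
    moreover have "q dvd Q" using h by (simp add: Q_def)
    ultimately have "q dvd 2 * B\<^sup>2 - Q\<^sup>2" by (simp add: power2_eq_square)
    then have "q dvd 1" using Q(2) by (metis add_diff_cancel_left')
    then show False using q1 by simp
  qed
  have QQ: "Q < Q\<^sup>2" using Q1 by (simp add: power2_eq_square)
  have "C\<^sup>2 < B\<^sup>2" using Q(1,2) QQ by linarith
  then have CB: "C < B" using Q(3) power2_less_imp_less by blast
  have "B\<^sup>2 < Q\<^sup>2" using Q(2) QQ Q1 by linarith
  then have BQ: "B < Q" using Q1 power2_less_imp_less[of B Q] by linarith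
  have coprime: "coprime Q d" if "\<not> q dvd d" for d
    using prime_imp_coprime[OF q(1) that] by (simp add: Q_def)
  have "Q dvd B - C \<or> Q dvd B + C"
    using dvd not_both coprime coprime_dvd_mult_left_iff coprime_dvd_mult_right_iff by blast
  then show False
  proof
    assume "Q dvd B - C"
    then show False using CB BQ Q(4) zdvd_imp_le[of Q "B - C"] by linarith
  next
    assume "Q dvd B + C"
    then obtain k where k: "B + C = Q * k" by blast
    have "0 < Q * k" "Q * k < Q * 2" using k CB BQ Q(3,4) by linarith+
    then have "k = 1" using Q1 by (auto simp: zero_less_mult_iff)
    then have BC: "B + C = Q" using k by simp
    have "Q * (Q - 1) = Q * (2 * (B - C))"
      using Q(1,2) unfolding BC[symmetric] by (simp add: algebra_simps power2_eq_square)
    then have "Q - 1 = 2 * (B - C)" using Q1 by simp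
    then have "4 * C = Q + 1" using BC by presburger
    then have "2 * (2 * C) = 2 * (C * C)" using Q(1) by (simp add: power2_eq_square)
    moreover have "C \<noteq> 0" using Q(1) Q1 by force
    ultimately have "C = 2" by simp
    then have "Q = 7" using Q(1) by simp
    then show False using Qmod by (simp add: cong_def)
  qed
qed

section \<open>Positive solutions of \<open>q X\<^sup>2 - (q - 1) Y\<^sup>2 = 1\<close>\<close>

text \<open>
  Infinite descent on \<open>Y\<close>.  The number \<open>(\<surd>q + \<surd>(q - 1))\<^sup>2 = (2 q - 1) + 2 \<surd>(q (q - 1))\<close> has norm 1, so
  dividing a solution \<open>X \<surd>q + Y \<surd>(q - 1)\<close> by it yields another one, \<open>(X', Y')\<close>.  As long as
  \<open>Y > 1\<close>, the new solution is again positive and has a smaller second component.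
\<close>

lemma pell_pos_solution_power:
  fixes q X Y :: int
  assumes "q > 1" "X > 0" "Y > 0" "q * X\<^sup>2 - (q - 1) * Y\<^sup>2 = 1"
  shows "\<exists>i. of_int X * sqrt q + of_int Y * sqrt (q - 1) = (sqrt q + sqrt (q - 1)) ^ (2 * i + 1)"
  using assms(2-4)
proof (induction "nat Y" arbitrary: X Y rule: less_induct)
  case less
  note eq = less.prems(3)
  have diff: "Y\<^sup>2 - 1 = q * (Y\<^sup>2 - X\<^sup>2)" using eq by (simp add: algebra_simps)
  show ?case
  proof (cases "Y = 1")
    case True
    then have "X\<^sup>2 = 1" using diff assms(1) by simp
    then have "X = 1" using less.prems(1) by (simp add: power2_eq_1_iff)
    with True show ?thesis by (intro exI[of _ 0]) simp
  next
    case False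
    then have Y: "Y \<ge> 2" using less.prems(2) by simp
    define X' Y' where "X' = (2 * q - 1) * X - 2 * (q - 1) * Y"
      and "Y' = (2 * q - 1) * Y - 2 * q * X"
    have eq': "q * X'\<^sup>2 - (q - 1) * Y'\<^sup>2 = 1"
    proof -
      have "q * X'\<^sup>2 - (q - 1) * Y'\<^sup>2 = q * X\<^sup>2 - (q - 1) * Y\<^sup>2"
        unfolding X'_def Y'_def by (simp add: algebra_simps power2_eq_square)
      then show ?thesis using eq by simp
    qed
    have "((2 * (q - 1)) * Y)\<^sup>2 < ((2 * q - 1) * X)\<^sup>2"
    proof -
      have "((2 * q - 1) * X)\<^sup>2 - ((2 * (q - 1)) * Y)\<^sup>2 = X\<^sup>2 + 4 * (q - 1) * (q * X\<^sup>2 - (q - 1) * Y\<^sup>2)"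
        by (simp add: algebra_simps power2_eq_square)
      also have "\<dots> > 0" unfolding eq using assms(1) by (simp add: add_nonneg_pos)
      finally show ?thesis by simp
    qed
    then have X': "X' > 0"
      using power2_less_imp_less[of "(2 * (q - 1)) * Y" "(2 * q - 1) * X"] assms(1) less.prems
      by (simp add: X'_def)
    have "Y\<^sup>2 > 1" using Y by (simp add: one_less_power)
    then have "Y\<^sup>2 > X\<^sup>2" using diff assms(1) by (metis diff_gt_0_iff_gt zero_less_mult_pos less_trans zero_less_one)
    then have XY: "X < Y" using less.prems(2) power2_less_imp_less by force
    \<comment> \<open>\<open>Y' > 0\<close> is equivalent to this bound.  It comes from \<open>Y\<^sup>2 - 1 = q (Y\<^sup>2 - X\<^sup>2)\<close>, in which
      \<open>X \<le> Y - 1\<close> makes the right-hand side at least \<open>q (2 Y - 1)\<close>.\<close>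
    have "Y\<^sup>2 > 4 * q"
    proof -
      have "X\<^sup>2 \<le> (Y - 1)\<^sup>2" using XY less.prems by (intro power_mono) auto
      then have "2 * Y - 1 \<le> Y\<^sup>2 - X\<^sup>2" by (simp add: power2_eq_square algebra_simps)
      then have *: "q * (2 * Y - 1) \<le> Y\<^sup>2 - 1" unfolding diff using assms(1) by simp
      have "(2 * q) * (Y - 1) \<le> (Y + 1) * (Y - 1)"
      proof -
        have "(2 * q) * (Y - 1) \<le> q * (2 * Y - 1)" using assms(1) by (simp add: algebra_simps)
        with * show ?thesis by (simp add: power2_eq_square algebra_simps)
      qed
      then have "2 * q \<le> Y + 1" using Y by (simp add: mult_le_cancel_right)
      moreover from this have "Y \<ge> 3" using assms(1) by simp
      moreover from this have "Y * Y \<ge> 3 * Y" by (intro mult_right_mono) auto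
      ultimately show ?thesis unfolding power2_eq_square by linarith
    qed
    then have "(2 * q * X)\<^sup>2 < ((2 * q - 1) * Y)\<^sup>2"
    proof -
      have "((2 * q - 1) * Y)\<^sup>2 - (2 * q * X)\<^sup>2 = Y\<^sup>2 - 4 * q * (q * X\<^sup>2 - (q - 1) * Y\<^sup>2)"
        by (simp add: algebra_simps power2_eq_square)
      also have "\<dots> > 0" unfolding eq using \<open>Y\<^sup>2 > 4 * q\<close> by simp
      finally show ?thesis by simp
    qed
    then have Y': "Y' > 0"
      using power2_less_imp_less[of "2 * q * X" "(2 * q - 1) * Y"] assms(1) less.prems
      by (simp add: Y'_def)
    have "((q - 1) * Y)\<^sup>2 < (q * X)\<^sup>2"
    proof -
      have "(q * X)\<^sup>2 - ((q - 1) * Y)\<^sup>2 = q * X\<^sup>2 + (q - 1) * (q * X\<^sup>2 - (q - 1) * Y\<^sup>2)"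
        by (simp add: algebra_simps power2_eq_square)
      also have "\<dots> > 0" unfolding eq using assms(1) by (simp add: add_nonneg_pos)
      finally show ?thesis by simp
    qed
    then have "(q - 1) * Y < q * X"
      using power2_less_imp_less assms(1) less.prems by force
    then have "Y' < Y" by (simp add: Y'_def algebra_simps)
    then have "nat Y' < nat Y" using Y' by simp
    from less.hyps[OF this X' Y' eq'] obtain i where
      i: "of_int X' * sqrt q + of_int Y' * sqrt (q - 1) = (sqrt q + sqrt (q - 1)) ^ (2 * i + 1)"
      by blast
    define z w where "z = sqrt q" and "w = sqrt (q - 1)"
    have zw: "z\<^sup>2 = of_int q" "w\<^sup>2 = of_int (q - 1)"
      using assms(1) by (auto simp: z_def w_def)
    have "X = (q + (q - 1)) * X' + 2 * (q - 1) * Y'" "Y = (q + (q - 1)) * Y' + 2 * q * X'"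
      unfolding X'_def Y'_def by (simp_all add: algebra_simps)
    then have XY_real:
      "real_of_int X = (z\<^sup>2 + w\<^sup>2) * of_int X' + 2 * w\<^sup>2 * of_int Y'"
      "real_of_int Y = (z\<^sup>2 + w\<^sup>2) * of_int Y' + 2 * z\<^sup>2 * of_int X'"
      unfolding zw by (metis of_int_add of_int_mult of_int_numeral)+
    have "of_int X * z + of_int Y * w = (z + w)\<^sup>2 * (of_int X' * z + of_int Y' * w)"
      unfolding XY_real by (simp add: algebra_simps power2_eq_square)
    also have "\<dots> = (z + w) ^ (2 * Suc i + 1)"
      using i by (simp add: z_def w_def power_add power2_eq_square mult.assoc)
    finally show ?thesis unfolding z_def w_def by blast
  qed
qed

lemma sum_odd_terms:
  fixes f :: "nat \<Rightarrow> 'a :: comm_monoid_add"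
  shows "(\<Sum>t\<le>2 * i + 1. if odd t then f t else 0) = (\<Sum>s\<le>i. f (2 * s + 1))"
proof (induction i)
  case (Suc i)
  have "{..2 * Suc i + 1} = insert (2 * i + 3) (insert (2 * i + 2) {..2 * i + 1})" by auto
  with Suc show ?case by (simp add: add.commute numeral_3_eq_3)
qed (simp add: numeral_1_eq_Suc_0)

text \<open>
  The variables are to be \<open>\<surd>q\<close> and \<open>\<surd>(q - 1)\<close>.  Adding the conjugate removes the odd powers of
  \<open>w\<close>, and what remains is \<open>2 z\<close> times a polynomial in \<open>z\<^sup>2\<close> and \<open>w\<^sup>2\<close>.
\<close>

lemma odd_power_sum_conjugate:
  fixes z w :: real
  shows "(z + w) ^ (2 * i + 1) + (z - w) ^ (2 * i + 1) =
    2 * z * (\<Sum>s\<le>i. of_nat ((2 * i + 1) choose (2 * s + 1)) * (z\<^sup>2) ^ s * (w\<^sup>2) ^ (i - s))"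
proof -
  let ?j = "2 * i + 1"
  have "(z + w) ^ ?j + (z - w) ^ ?j =
     (\<Sum>t\<le>?j. of_nat (?j choose t) * z ^ t * w ^ (?j - t) + of_nat (?j choose t) * z ^ t * (- w) ^ (?j - t))"
    using binomial_ring[of z w ?j] binomial_ring[of z "- w" ?j] by (simp only: sum.distrib diff_conv_add_uminus)
  also have "\<dots> = (\<Sum>t\<le>?j. if odd t then 2 * of_nat (?j choose t) * z ^ t * w ^ (?j - t) else 0)"
    by (intro sum.cong refl) (auto simp: power_minus_odd)
  also have "\<dots> = (\<Sum>s\<le>i. 2 * of_nat (?j choose (2 * s + 1)) * z ^ (2 * s + 1) * w ^ (?j - (2 * s + 1)))"
    by (rule sum_odd_terms)
  also have "\<dots> = 2 * z * (\<Sum>s\<le>i. of_nat (?j choose (2 * s + 1)) * (z\<^sup>2) ^ s * (w\<^sup>2) ^ (i - s))"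
    unfolding sum_distrib_left
    by (intro sum.cong refl) (simp add: power_mult[symmetric] diff_mult_distrib2 algebra_simps)
  finally show ?thesis .
qed

text \<open>
  The conjugates \<open>X z - Y w\<close> and \<open>(z - w) ^ (2 i + 1)\<close> are the inverses of \<open>X z + Y w\<close> and
  \<open>(z + w) ^ (2 i + 1)\<close>, so they agree whenever the latter do.  This isolates \<open>X\<close> without any
  appeal to the irrationality of the square roots.
\<close>

lemma pell_pos_solution_binomial:
  fixes q X Y :: int
  assumes q: "q > 1" and pos: "X > 0" "Y > 0" and eq: "q * X\<^sup>2 - (q - 1) * Y\<^sup>2 = 1"
  obtains i where "X = (\<Sum>s\<le>i. int ((2 * i + 1) choose (2 * s + 1)) * q ^ s * (q - 1) ^ (i - s))"
proof -
  define z w where "z = sqrt q" and "w = sqrt (q - 1)"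
  have zw: "z\<^sup>2 = of_int q" "w\<^sup>2 = of_int (q - 1)" "z > 0"
    using q by (auto simp: z_def w_def)
  obtain i where i: "of_int X * z + of_int Y * w = (z + w) ^ (2 * i + 1)"
    using pell_pos_solution_power[OF assms] unfolding z_def w_def by blast
  have "(z + w) * (z - w) = 1" using zw by (simp add: algebra_simps power2_eq_square)
  then have "(z + w) ^ (2 * i + 1) * (z - w) ^ (2 * i + 1) = 1"
    by (metis power_mult_distrib power_one)
  moreover have "(of_int X * z + of_int Y * w) * (of_int X * z - of_int Y * w) = 1"
  proof -
    have "(of_int X * z + of_int Y * w) * (of_int X * z - of_int Y * w)
        = of_int X ^ 2 * z ^ 2 - of_int Y ^ 2 * w ^ 2"
      by (simp add: algebra_simps power2_eq_square)
    also have "\<dots> = of_int (q * X\<^sup>2 - (q - 1) * Y\<^sup>2)" unfolding zw by simp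
    finally show ?thesis using eq by simp
  qed
  ultimately have "of_int X * z - of_int Y * w = (z - w) ^ (2 * i + 1)"
    unfolding i by (metis mult_cancel_left mult_zero_left zero_neq_one)
  then have "2 * z * of_int X = (z + w) ^ (2 * i + 1) + (z - w) ^ (2 * i + 1)"
    unfolding i[symmetric] by (simp add: algebra_simps)
  also have "\<dots> = 2 * z * of_int (\<Sum>s\<le>i. int ((2 * i + 1) choose (2 * s + 1)) * q ^ s * (q - 1) ^ (i - s))"
    unfolding odd_power_sum_conjugate zw by simp
  finally have "X = (\<Sum>s\<le>i. int ((2 * i + 1) choose (2 * s + 1)) * q ^ s * (q - 1) ^ (i - s))"
    using zw(3) by (simp only: mult_cancel_left of_int_eq_iff) simp
  then show ?thesis using that by blast
qed

section \<open>Divisibility of the first component by powers of \<open>q\<close>\<close>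

lemma odd_less_power: "s > 0 \<Longrightarrow> q \<ge> 5 \<Longrightarrow> 2 * int s + 1 < (q::int) ^ s"
proof (induction s rule: nat_induct_non_zero)
  case (Suc s)
  have "5 * q ^ s \<le> q * q ^ s" using Suc by (intro mult_right_mono) auto
  moreover have "q ^ s > 0" using Suc by simp
  ultimately have "2 * int s + 3 < q * q ^ s" using Suc by linarith
  then show ?case by simp
qed simp

text \<open>
  By the absorption identity, \<open>(2 s + 1) (j choose (2 s + 1))\<close> is a multiple of \<open>j\<close>, so the binomial
  coefficient loses at most the \<open>v\<close> factors \<open>q\<close> of \<open>2 s + 1\<close>.  Since
  \<open>q ^ v \<le> 2 s + 1 < q ^ s\<close>, the factor \<open>q ^ s\<close> more than makes up for the loss.  The strict
  inequality fails for \<open>q = 3\<close> and \<open>s = 1\<close>, and indeed \<open>1 + 3 + \<dots> + 3 ^ 4 = 11\<^sup>2\<close>.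
\<close>

lemma prime_power_dvd_binomial_term:
  fixes q :: int
  assumes q: "prime q" "q \<ge> 5" and s: "s > 0" and dvd: "q ^ l dvd int j"
  shows "q ^ Suc l dvd int (j choose (2 * s + 1)) * q ^ s"
proof -
  define C where "C = int (j choose (2 * s + 1))"
  have "int (2 * s + 1) \<noteq> 0" "\<not> is_unit q" using q by auto
  then obtain w where w: "int (2 * s + 1) = q ^ multiplicity q (int (2 * s + 1)) * w" "\<not> q dvd w"
    using multiplicity_decompose' by blast
  define v where "v = multiplicity q (int (2 * s + 1))"
  have "q ^ v \<le> int (2 * s + 1)" unfolding v_def by (intro zdvd_imp_le multiplicity_dvd) simp
  also have "\<dots> < q ^ s" using odd_less_power[OF s q(2)] by simp
  finally have v: "v < s" using q(2) by (simp add: power_less_imp_less_exp)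
  have "int (2 * s + 1) * C = int j * int ((j - 1) choose (2 * s))"
    unfolding C_def using times_binomial_minus1_eq[of "2 * s + 1" j]
    by (metis add_diff_cancel_right' of_nat_mult zero_less_Suc Suc_eq_plus1)
  then have "q ^ l dvd int (2 * s + 1) * C" using dvd by simp
  then have "q ^ l dvd w * (q ^ v * C)" using w(1) by (simp add: v_def mult_ac)
  moreover have "coprime (q ^ l) w" using prime_imp_coprime[OF q(1) w(2)] by simp
  ultimately have "q ^ l dvd q ^ v * C" by (simp add: coprime_dvd_mult_right_iff)
  then have "q ^ Suc l dvd q ^ Suc v * C" by simp
  also have "\<dots> dvd q ^ s * C" using v by (intro mult_dvd_mono le_imp_power_dvd) auto
  finally show ?thesis by (simp add: C_def mult.commute)
qed

text \<open>
  If \<open>q ^ m\<close> divides \<open>j = 2 i + 1\<close>, then \<open>q ^ (m + 1)\<close> divides every term except the one with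
  \<open>s = 0\<close>, which is \<open>j (q - 1) ^ i\<close>.  So if \<open>q ^ (m + 1)\<close> divides the sum, it divides this term as
  well, and \<open>q - 1\<close> is coprime to \<open>q\<close>.
\<close>

lemma prime_power_dvd_binomial_sum:
  fixes q :: int
  assumes q: "prime q" "q \<ge> 5"
    and dvd: "q ^ m dvd (\<Sum>s\<le>i. int ((2 * i + 1) choose (2 * s + 1)) * q ^ s * (q - 1) ^ (i - s))"
  shows "q ^ m dvd int (2 * i + 1)"
  using dvd
proof (induction m)
  case (Suc m)
  let ?f = "\<lambda>s. int ((2 * i + 1) choose (2 * s + 1)) * q ^ s * (q - 1) ^ (i - s)"
  have "q ^ m dvd int (2 * i + 1)"
    using Suc by (meson dvd_trans le_imp_power_dvd lessI less_imp_le)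
  then have "q ^ Suc m dvd sum ?f {1..i}"
    by (intro dvd_sum dvd_mult2 prime_power_dvd_binomial_term q) auto
  moreover have "sum ?f {..i} = ?f 0 + sum ?f {1..i}"
  proof -
    have "{..i} = insert 0 {1..i}" by auto
    then have "sum ?f {..i} = sum ?f (insert 0 {1..i})" by (rule arg_cong)
    also have "\<dots> = ?f 0 + sum ?f {1..i}" by (rule sum.insert) simp_all
    finally show ?thesis .
  qed
  ultimately have "q ^ Suc m dvd ?f 0"
    using Suc.prems dvd_add_left_iff[of "q ^ Suc m" "sum ?f {1..i}" "?f 0"] by (simp only:)
  then have "q ^ Suc m dvd int (2 * i + 1) * (q - 1) ^ i" by simp
  moreover have "coprime (q ^ Suc m) ((q - 1) ^ i)"
    using coprime_diff_one_left[of q] by (simp add: coprime_commute)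
  ultimately show ?case using coprime_dvd_mult_left_iff by blast
qed simp

text \<open>
  The pair \<open>(q ^ m, \<bar>a\<bar>)\<close> would solve \<open>q X\<^sup>2 - (q - 1) Y\<^sup>2 = 1\<close>, so \<open>q ^ m\<close> would divide \<open>2 i + 1\<close> for
  the index \<open>i\<close> of its expansion.  Here \<open>i > 0\<close> because \<open>q ^ m > 1\<close>, and the term
  \<open>(2 i + 1) (q - 1) ^ i\<close> of the expansion alone is already larger than \<open>2 i + 1\<close>.
\<close>

lemma no_odd_repunit_square:
  fixes q a :: int
  assumes q: "prime q" "q \<ge> 5" and m: "m > 0"
  shows "(q - 1) * a\<^sup>2 \<noteq> q ^ (2 * m + 1) - 1"
proof
  assume eq: "(q - 1) * a\<^sup>2 = q ^ (2 * m + 1) - 1"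
  have qm: "q ^ m > 1" using q m by (simp add: one_less_power)
  have eq': "q * (q ^ m)\<^sup>2 - (q - 1) * \<bar>a\<bar>\<^sup>2 = 1"
    using eq by (simp add: power_mult[symmetric] mult.commute)
  have "\<bar>a\<bar> > 0"
  proof (rule ccontr)
    assume "\<not> \<bar>a\<bar> > 0"
    then have "q * (q ^ m)\<^sup>2 = 1" using eq' by simp
    then have "q dvd 1" by (metis dvd_triv_left)
    then show False using q by simp
  qed
  then obtain i where
    i: "q ^ m = (\<Sum>s\<le>i. int ((2 * i + 1) choose (2 * s + 1)) * q ^ s * (q - 1) ^ (i - s))"
    using pell_pos_solution_binomial[OF _ _ _ eq'] q(2) qm by auto
  then have "q ^ m dvd int (2 * i + 1)"
    by (intro prime_power_dvd_binomial_sum q) simp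
  then have le: "q ^ m \<le> int (2 * i + 1)" by (intro zdvd_imp_le) auto
  have "i > 0"
  proof (rule ccontr)
    assume "\<not> i > 0"
    then show False using i qm by simp
  qed
  let ?f = "\<lambda>s. int ((2 * i + 1) choose (2 * s + 1)) * q ^ s * (q - 1) ^ (i - s)"
  have "int (2 * i + 1) * 1 < int (2 * i + 1) * (q - 1) ^ i"
    using q(2) \<open>i > 0\<close> by (intro mult_strict_left_mono one_less_power) auto
  also have "\<dots> = ?f 0" by simp
  also have "\<dots> \<le> sum ?f {..i}"
    using q(2) by (intro member_le_sum) auto
  finally show False using le i by simp
qed

section \<open>The equation \<open>2 n\<^sup>2 = \<sigma>(q ^ \<alpha>)\<close>\<close>

theorem theorem2p1:
  shows "\<not> (\<exists>(\<alpha>::int) (n::int) (q::int).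
    \<alpha> > 1 \<and> prime q \<and> [q = 1] (mod 4) \<and> 2 * n\<^sup>2 = sigma (q ^ nat \<alpha>))"
proof
  assume "\<exists>(\<alpha>::int) (n::int) (q::int).
    \<alpha> > 1 \<and> prime q \<and> [q = 1] (mod 4) \<and> 2 * n\<^sup>2 = sigma (q ^ nat \<alpha>)"
  then obtain \<alpha> n q :: int where \<alpha>: "\<alpha> > 1" and q: "prime q" "[q = 1] (mod 4)"
    and n: "2 * n\<^sup>2 = sigma (q ^ nat \<alpha>)" by blast
  let ?S = "\<lambda>k. \<Sum>i<k. q ^ i"
  have "q > 1" using q(1) prime_gt_1_int by blast
  moreover have "q mod 4 = 1" using q(2) by (simp add: cong_def)
  ultimately have q5: "q \<ge> 5" and "odd q" by presburger+
  have S_pos: "?S k > 0" if "k > 0" for k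
    using q5 that by (intro sum_pos) auto
  define N where "N = Suc (nat \<alpha>)"
  have N: "2 * n\<^sup>2 = ?S N"
    unfolding n N_def sigma_prime_power[OF q(1)] lessThan_Suc_atMost ..
  have "even (?S k) \<longleftrightarrow> even k" for k using \<open>odd q\<close> by (induction k) auto
  then have "even N" using N by (metis dvd_triv_left)
  then obtain k where k: "N = 2 * k" by blast
  have k2: "k \<ge> 2" using \<alpha> k unfolding N_def by linarith
  obtain r where r: "q ^ k + 1 = 2 * r" "odd r" "r > 0" "coprime (?S k) r"
    using half_power_plus_one[OF q(2), of k] q5 by auto
  have "?S k * r = n\<^sup>2" using N unfolding k geometric_sum_double r(1) by simp
  then obtain a b where a: "?S k = a\<^sup>2" and b: "r = b\<^sup>2"
    using coprime_mult_square_int[OF r(4) S_pos] r(3) k2 by fastforce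
  show False
  proof (cases "even k")
    case False
    then obtain m where m: "k = 2 * m + 1" by (elim oddE)
    have "(q - 1) * a\<^sup>2 = q ^ (2 * m + 1) - 1"
      unfolding a[symmetric] geometric_sum_mult m ..
    moreover have "m > 0" using k2 m by simp
    ultimately show False using no_odd_repunit_square[OF q(1) q5] by blast
  next
    case True
    then obtain h where h: "k = 2 * h" by blast
    have "h > 0" using k2 h by simp
    obtain t where t: "q ^ h + 1 = 2 * t" "odd t" "t > 0" "coprime (?S h) t"
      using half_power_plus_one[OF q(2), of h] q5 by auto
    have "(2 * ?S h) * t = a\<^sup>2"
      unfolding a[symmetric] h geometric_sum_double t(1) by simp
    moreover have "coprime (2 * ?S h) t" using t(2,4) by simp
    ultimately obtain c where "t = c\<^sup>2"
      using coprime_mult_square_int(2)[of "2 * ?S h" t a] S_pos[OF \<open>h > 0\<close>] t(3) by auto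
    then have "q ^ h + 1 = 2 * c\<^sup>2" using t(1) by simp
    moreover have "(q ^ h)\<^sup>2 + 1 = 2 * b\<^sup>2"
      using r(1) b h by (simp add: power_mult[symmetric] mult.commute)
    ultimately show False using no_simultaneous_squares[OF q \<open>h > 0\<close>] by blast
  qed
qed

end
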